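(* For a subset $\widehat{\Lambda}\subseteq\Lambda$ let $$\mathrm{GF}_{\widehat{\Lambda}}(y_1,y_2,y_3)=\mathrm{GF}_{\widehat{\Lambda}}(y_1,y_2,y_3;q):=\sum_{\lambda\in\widehat{\Lambda}} y_1^{\mathrm{len}_R(\lambda)}\,y_2^{\mathrm{len}_G(\lambda)}\,y_3^{\mathrm{len}_B(\lambda)}\,q^{|\lambda|},$$ and let $$T(y_1,y_2,y_3)=T(y_1,y_2,y_3;q):=\sum_{n_1,n_2,n_3\ge 0} q^{3\binom{n_1}{2}+\binom{n_2}{2}+\binom{n_3}{2}+n_1n_2+n_2n_3+n_3n_1}\,\frac{y_1^{n_1}y_2^{n_2}y_3^{n_3}\,(-q;q)_{n_1+n_2+n_3}}{(q^2;q^2)_{n_1}(q^2;q^2)_{n_2}(q^2;q^2)_{n_3}}.$$ Then $$\mathrm{GF}_{\Lambda}(y_1,y_2,y_3)=T(y_1q,\,y_2q,\,y_3q^2)+y_3q\,T(y_1q^3,\,y_2q^3,\,y_3q^2),$$ $$\mathrm{GF}_{\Lambda_{\{1_R\}}}(y_1,y_2,y_3)=T(y_1q^2,\,y_2q^2,\,y_3q)+y_2q\,T(y_1q^4,\,y_2q^2,\,y_3q^3),$$ $$\mathrm{GF}_{\Lambda_{\{1_R,2_R,1_B\}}}(y_1,y_2,y_3)=T(y_1q^3,\,y_2q,\,y_3q^2),$$ $$\mathrm{GF}_{\Lambda_{\{1_R,1_G\}}}(y_1,y_2,y_3)=T(y_1q^2,\,y_2q^2,\,y_3q).$$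
   Context: A three-colored partition is a finite (possibly empty) partition into positive integer parts in which each part is assigned one of three colors: red, green, blue, indicated by subscripts $R,G,B$ (so $j_R$ is a red part of size $j$, etc.). For a three-colored partition $\lambda$, $|\lambda|$ is the sum of its parts, and $\mathrm{len}_R(\lambda),\mathrm{len}_G(\lambda),\mathrm{len}_B(\lambda)$ are the numbers of red, green and blue parts, respectively. $\Lambda$ is the set of three-colored partitions (including the empty one) such that: (i) each part size, counting all three colors together, appears at most once; (ii) for every $j\ge 1$, none of the following pairs of parts both occur: $j_R$ and $(j+1)_R$; $j_R$ and $(j+2)_R$; $j_R$ and $(j+1)_B$; $j_G$ and $(j+1)_R$; $j_G$ and $(j+2)_R$; $j_G$ and $(j+1)_B$; $j_B$ and $(j+1)_R$; $j_B$ and $(j+1)_G$. For a collection $S$ of colored parts, $\Lambda_S$ is the subset of $\Lambda$ consisting of the partitions having no parts from $S$. The $q$-Pochhammer symbol is $(A;q)_n:=\prod_{k=0}^{n-1}(1-Aq^k)$ for $n\in\mathbb{N}\cup\{\infty\}$. Identities are between formal power series in $y_1,y_2,y_3,q$. *)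

theory Defs
  imports "HOL-Analysis.Analysis" "HOL-Computational_Algebra.Formal_Power_Series"
    "HOL-Library.Multiset"
begin

section \<open>Three-colored partitions\<close>

datatype color = R | G | B

text \<open>The part \<open>j\<^sub>c\<close> is the pair \<open>(j, c)\<close>; a three-colored partition is a finite multiset of parts.\<close>

type_synonym cpart = "nat \<times> color"

definition three_colored_partition :: "cpart multiset \<Rightarrow> bool" where
  "three_colored_partition \<mu> \<longleftrightarrow> (\<forall>p\<in>#\<mu>. fst p \<ge> 1)"

definition weight :: "cpart multiset \<Rightarrow> nat" where
  "weight \<mu> = (\<Sum>p\<in>#\<mu>. fst p)"

definition len :: "color \<Rightarrow> cpart multiset \<Rightarrow> nat" where
  "len c \<mu> = size {#p \<in># \<mu>. snd p = c#}"

definition forbidden_pairs :: "(cpart \<times> cpart) set" where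
  "forbidden_pairs = (\<Union>j\<in>{1..}.
     { ((j, R), (j + 1, R)), ((j, R), (j + 2, R)), ((j, R), (j + 1, B)),
       ((j, G), (j + 1, R)), ((j, G), (j + 2, R)), ((j, G), (j + 1, B)),
       ((j, B), (j + 1, R)), ((j, B), (j + 1, G)) })"

definition Lam :: "cpart multiset set" where
  "Lam = {\<mu>. three_colored_partition \<mu>
            \<and> (\<forall>j. size {#p \<in># \<mu>. fst p = j#} \<le> 1)
            \<and> (\<forall>(p, p') \<in> forbidden_pairs. \<not> (p \<in># \<mu> \<and> p' \<in># \<mu>))}"

definition Lam_avoid :: "cpart set \<Rightarrow> cpart multiset set" where
  "Lam_avoid S = {\<mu> \<in> Lam. \<forall>p\<in>S. p \<notin># \<mu>}"


section \<open>Formal power series in four variables\<close>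

text \<open>
  The ring \<open>\<rat>[[y\<^sub>1, y\<^sub>2, y\<^sub>3, q]]\<close> is rendered as \<open>\<rat>[[y\<^sub>1]][[y\<^sub>2]][[y\<^sub>3]][[q]]\<close>, with \<open>q\<close> the outermost
  variable. Infinite sums are taken in the library topology of the type of formal power series,
  which here is the \<open>q\<close>-adic one: the coefficient ring \<open>\<rat>[[y\<^sub>1]][[y\<^sub>2]][[y\<^sub>3]]\<close> is discrete.
\<close>

type_synonym series = "rat fps fps fps fps"

definition q :: series where "q = fps_X"
definition y3 :: series where "y3 = fps_const fps_X"
definition y2 :: series where "y2 = fps_const (fps_const fps_X)"
definition y1 :: series where "y1 = fps_const (fps_const (fps_const fps_X))"

definition qpoch :: "'a::comm_ring_1 \<Rightarrow> 'a \<Rightarrow> nat \<Rightarrow> 'a" where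
  "qpoch a r n = (\<Prod>k<n. 1 - a * r ^ k)"

definition GF :: "cpart multiset set \<Rightarrow> series \<Rightarrow> series \<Rightarrow> series \<Rightarrow> series" where
  "GF L z1 z2 z3 = (\<Sum>\<^sub>\<infinity>\<mu>\<in>L. z1 ^ len R \<mu> * z2 ^ len G \<mu> * z3 ^ len B \<mu> * q ^ weight \<mu>)"

definition T_term :: "series \<Rightarrow> series \<Rightarrow> series \<Rightarrow> nat \<Rightarrow> nat \<Rightarrow> nat \<Rightarrow> series" where
  "T_term z1 z2 z3 n1 n2 n3 =
     q ^ (3 * (n1 choose 2) + (n2 choose 2) + (n3 choose 2) + n1 * n2 + n2 * n3 + n3 * n1) *
     ((z1 ^ n1 * z2 ^ n2 * z3 ^ n3 * qpoch (- q) q (n1 + n2 + n3)) /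
      (qpoch (q^2) (q^2) n1 * qpoch (q^2) (q^2) n2 * qpoch (q^2) (q^2) n3))"

definition T :: "series \<Rightarrow> series \<Rightarrow> series \<Rightarrow> series" where
  "T z1 z2 z3 = (\<Sum>\<^sub>\<infinity>(n1, n2, n3)\<in>UNIV. T_term z1 z2 z3 n1 n2 n3)"


section \<open>The sums converge and the divisions are exact\<close>

lemma fps_summable_onI:
  fixes f :: "'i \<Rightarrow> 'a::ab_group_add fps"
  assumes fin: "\<And>n. finite {i\<in>A. fps_nth (f i) n \<noteq> 0}"
  shows "f summable_on A"
proof -
  let ?S = "\<lambda>n. {i\<in>A. fps_nth (f i) n \<noteq> 0}"
  let ?g = "Abs_fps (\<lambda>n. \<Sum>i\<in>?S n. fps_nth (f i) n)"
  have "(sum f \<longlongrightarrow> ?g) (finite_subsets_at_top A)"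
    unfolding tendsto_fps_iff
  proof
    fix n
    have "fps_nth (sum f F) n = fps_nth ?g n" if "finite F" "?S n \<subseteq> F" "F \<subseteq> A" for F
    proof -
      have "fps_nth (sum f F) n = (\<Sum>i\<in>F. fps_nth (f i) n)"
        by (simp add: fps_sum_nth)
      also have "\<dots> = (\<Sum>i\<in>?S n. fps_nth (f i) n)"
        using that by (intro sum.mono_neutral_right) auto
      finally show ?thesis by simp
    qed
    then show "\<forall>\<^sub>F F in finite_subsets_at_top A. fps_nth (sum f F) n = fps_nth ?g n"
      unfolding eventually_finite_subsets_at_top using fin[of n]
      by (intro exI[of _ "?S n"]) auto
  qed
  then show ?thesis
    unfolding summable_on_def has_sum_def by blast
qed

lemma nth_q_power_mult: "fps_nth (q ^ e * f) n = (if n < e then 0 else fps_nth f (n - e))"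
  by (simp add: q_def fps_X_power_mult_nth)

lemma finite_Lam_weight_le: "finite {\<mu>\<in>Lam. weight \<mu> \<le> n}"
proof -
  have fin_col: "finite (UNIV :: color set)"
  proof (rule finite_subset)
    show "UNIV \<subseteq> {R, G, B}" using color.exhaust by blast
  qed simp
  have "{\<mu>\<in>Lam. weight \<mu> \<le> n} \<subseteq> mset_set ` Pow ({..n} \<times> UNIV)"
  proof
    fix \<mu> assume "\<mu> \<in> {\<mu>\<in>Lam. weight \<mu> \<le> n}"
    then have L: "\<mu> \<in> Lam" and w: "weight \<mu> \<le> n" by auto
    have le1: "count \<mu> p \<le> 1" for p
    proof -
      have "count \<mu> p = count {#x \<in># \<mu>. fst x = fst p#} p" by simp
      also have "\<dots> \<le> size {#x \<in># \<mu>. fst x = fst p#}" by (rule count_le_size)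
      also have "\<dots> \<le> 1" using L unfolding Lam_def by blast
      finally show ?thesis .
    qed
    have "\<mu> = mset_set (set_mset \<mu>)"
    proof (rule multiset_eqI)
      fix p
      have "count \<mu> p = 1" if "p \<in># \<mu>"
        using le1[of p] iffD2[OF count_greater_zero_iff that] by linarith
      then show "count \<mu> p = count (mset_set (set_mset \<mu>)) p"
        by (cases "p \<in># \<mu>") (auto simp: not_in_iff)
    qed
    moreover have "set_mset \<mu> \<subseteq> {..n} \<times> UNIV"
    proof
      fix p assume "p \<in># \<mu>"
      then obtain \<nu> where "\<mu> = add_mset p \<nu>" by (meson mset_add)
      then have "weight \<mu> = fst p + weight \<nu>" by (simp add: weight_def)
      with w show "p \<in> {..n} \<times> UNIV" by (cases p) auto
    qed
    ultimately show "\<mu> \<in> mset_set ` Pow ({..n} \<times> UNIV)" by blast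
  qed
  then show ?thesis
    by (rule finite_subset) (simp add: fin_col)
qed

lemma GF_summable:
  assumes "L \<subseteq> Lam"
  shows "(\<lambda>\<mu>. z1 ^ len R \<mu> * z2 ^ len G \<mu> * z3 ^ len B \<mu> * q ^ weight \<mu>) summable_on L"
proof (rule fps_summable_onI)
  fix n
  show "finite {\<mu>\<in>L. fps_nth (z1 ^ len R \<mu> * z2 ^ len G \<mu> * z3 ^ len B \<mu> * q ^ weight \<mu>) n \<noteq> 0}"
    by (rule finite_subset[OF _ finite_Lam_weight_le[of n]])
      (use assms in \<open>auto simp: nth_q_power_mult mult.commute[of _ "q ^ _"] split: if_splits\<close>)
qed

lemma T_exponent:
  "3 * (n1 choose 2) + (n2 choose 2) + (n3 choose 2) + n1 * n2 + n2 * n3 + n3 * n1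
     = ((n1 + n2 + n3) choose 2) + 2 * (n1 choose 2)"
proof -
  have "((m + n) choose 2) = (m choose 2) + (n choose 2) + m * n" for m n :: nat
    by (induction n) (auto simp: numeral_2_eq_2)
  then show ?thesis by (simp add: algebra_simps)
qed

lemma T_summable: "(\<lambda>(n1, n2, n3). T_term z1 z2 z3 n1 n2 n3) summable_on UNIV"
proof (rule fps_summable_onI)
  fix n
  have lb: "m \<le> Suc (m choose 2)" for m :: nat
    by (induction m) (auto simp: numeral_2_eq_2)
  have "(n1, n2, n3) \<in> {..Suc n} \<times> {..Suc n} \<times> {..Suc n}"
    if "fps_nth (T_term z1 z2 z3 n1 n2 n3) n \<noteq> 0" for n1 n2 n3
  proof -
    have "((n1 + n2 + n3) choose 2) \<le> n"
      using that unfolding T_term_def T_exponent nth_q_power_mult by (auto split: if_splits)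
    with lb[of "n1 + n2 + n3"] show ?thesis by auto
  qed
  then have "{p \<in> UNIV. fps_nth (case p of (n1, n2, n3) \<Rightarrow> T_term z1 z2 z3 n1 n2 n3) n \<noteq> 0}
      \<subseteq> {..Suc n} \<times> {..Suc n} \<times> {..Suc n}"
    by auto
  then show "finite {p \<in> UNIV. fps_nth (case p of (n1, n2, n3) \<Rightarrow> T_term z1 z2 z3 n1 n2 n3) n \<noteq> 0}"
    by (rule finite_subset) simp
qed

lemma series_divide_mult_cancel:
  fixes f g :: series
  assumes "fps_nth g 0 = 1"
  shows "f / g * g = f"
proof -
  have inv1: "inverse (1 :: rat fps fps fps) = 1"
    by (rule fps_inverse_one', rule fps_inverse_one', rule fps_inverse_one', rule inverse_1)
  have "g * inverse g = 1"
    by (subst fps_inverse_def, rule fps_right_inverse) (simp add: assms inv1)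
  moreover have "f / g = f * inverse g"
    by (rule fps_divide_unit) (simp add: assms)
  ultimately show ?thesis by (simp add: mult.assoc mult.commute[of _ g])
qed

lemma qpoch_q2_nth_0: "fps_nth (qpoch (q^2) (q^2) n) 0 = 1"
  by (induction n) (simp_all add: qpoch_def q_def)

end

theory Submission
  imports Defs
begin

text \<open>
  Deleting the part of size 1, if there is one, and decreasing all other parts by 1 turns a
  partition with weights \<open>y\<^sub>i\<close> into one with weights \<open>y\<^sub>i q\<close>, and the deleted part only constrains
  what is left through the parts of size 1 and 2. The four sets of the theorem are closed under
  this operation, so their generating functions satisfy a system of four \<open>q\<close>-difference equations.
  The four combinations of \<open>T\<close> satisfy the same system: by coefficient comparison,
  \<^item> \<open>T(a, b, c) = T(a, b, c q\<^sup>2) + c T(a q, b q, c q) + c q T(a q\<^sup>2, b q\<^sup>2, c q\<^sup>2)\<close>,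
    and the same with the roles of \<open>b\<close> and \<open>c\<close> exchanged;
  \<^item> \<open>T(a, b, c q) + c T(a q\<^sup>2, b q\<^sup>2, c q) = T(a q, b q, c) + (a + b) T(a q\<^sup>3, b q, c q\<^sup>2)\<close>.

  At \<open>y\<^sub>i q\<^sup>k\<close> both sides are 1 modulo \<open>q\<^sup>k\<close>. Iterating the system, the difference
  of the two solutions is divisible by every power of \<open>q\<close>.
\<close>

section \<open>Sums of formal power series\<close>

text \<open>Convergence means that every coefficient is eventually constant, and coefficient
  \<open>n\<close> of a sum depends only on coefficient \<open>n\<close> of the summands. The
  instance makes \<open>has_sum_add\<close> available.\<close>

instance fps :: (ab_group_add) topological_comm_monoid_add
proof
  fix a b :: "'a fps"
  have ev: "\<forall>\<^sub>F x in nhds c. fps_nth x n = fps_nth c n" for n and c :: "'a fps"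
    using filterlim_ident[of "nhds c"] unfolding tendsto_fps_iff by blast
  show "((\<lambda>x. fst x + snd x) \<longlongrightarrow> a + b) (nhds a \<times>\<^sub>F nhds b)"
    unfolding tendsto_fps_iff
  proof
    fix n
    show "\<forall>\<^sub>F x in nhds a \<times>\<^sub>F nhds b. fps_nth (fst x + snd x) n = fps_nth (a + b) n"
      using eventually_prodI[OF ev[of n a] ev[of n b]] by eventually_elim simp
  qed
qed

text \<open>Coefficient \<open>n\<close> of a product depends only on the coefficients up to
  \<open>n\<close> of the factors. The instance serves \<open>has_sum_cmult_right\<close>.\<close>

instance fps :: (comm_ring_1) topological_semigroup_mult
proof
  fix a b :: "'a fps"
  have ev: "\<forall>\<^sub>F x in nhds c. \<forall>i\<in>{0..n}. fps_nth x i = fps_nth c i" for n and c :: "'a fps"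
    using filterlim_ident[of "nhds c"] unfolding tendsto_fps_iff
    by (intro eventually_ball_finite) auto
  show "((\<lambda>x. fst x * snd x) \<longlongrightarrow> a * b) (nhds a \<times>\<^sub>F nhds b)"
    unfolding tendsto_fps_iff
  proof
    fix n
    show "\<forall>\<^sub>F x in nhds a \<times>\<^sub>F nhds b. fps_nth (fst x * snd x) n = fps_nth (a * b) n"
      using eventually_prodI[OF ev[of n a] ev[of n b]]
      by eventually_elim (auto simp: fps_mult_nth intro!: sum.cong)
  qed
qed

lemma q_power_dvd_iff: "q ^ k dvd f \<longleftrightarrow> (\<forall>n<k. fps_nth f n = 0)"
proof
  assume "q ^ k dvd f"
  then show "\<forall>n<k. fps_nth f n = 0" by (auto simp: nth_q_power_mult)
next
  assume "\<forall>n<k. fps_nth f n = 0"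
  then have "f = q ^ k * fps_shift k f"
    by (intro fps_ext) (simp add: nth_q_power_mult)
  then show "q ^ k dvd f" by (rule dvdI)
qed

lemma all_q_powers_dvd_imp_zero: "(\<And>k. q ^ k dvd f) \<Longrightarrow> f = 0"
  unfolding q_power_dvd_iff by (rule fps_ext) (simp only: fps_zero_nth, blast)

text \<open>Modulo q^k only the term at \<open>i\<close> survives. This gives the initial values,
  with \<open>i\<close> the empty partition or the index (0, 0, 0).\<close>

lemma q_power_dvd_has_sum_diff:
  fixes f :: "'i \<Rightarrow> series"
  assumes sum: "(f has_sum S) A" and i: "i \<in> A"
    and dvd: "\<And>j. j \<in> A \<Longrightarrow> j \<noteq> i \<Longrightarrow> q ^ k dvd f j"
  shows "q ^ k dvd S - f i"
proof -
  have "\<forall>\<^sub>F F in finite_subsets_at_top A. \<forall>n\<in>{..<k}. fps_nth (sum f F) n = fps_nth S n"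
    using sum unfolding has_sum_def tendsto_fps_iff
    by (intro eventually_ball_finite) auto
  then have "\<exists>X. finite X \<and> X \<subseteq> A \<and> (\<forall>F. finite F \<and> X \<subseteq> F \<and> F \<subseteq> A \<longrightarrow>
      (\<forall>n\<in>{..<k}. fps_nth (sum f F) n = fps_nth S n))"
    by (simp only: eventually_finite_subsets_at_top)
  then obtain X where X: "finite X" "X \<subseteq> A"
    and nth: "\<forall>F. finite F \<and> X \<subseteq> F \<and> F \<subseteq> A \<longrightarrow>
      (\<forall>n\<in>{..<k}. fps_nth (sum f F) n = fps_nth S n)"
    by (elim exE conjE)
  \<comment> \<open>The sum over \<open>X\<close> already has the first \<open>k\<close>
    coefficients of \<open>S\<close>; inserting \<open>i\<close> keeps them and lets
    \<open>f i\<close> be split off.\<close>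
  let ?F = "insert i X"
  have "sum f ?F - f i = sum f (?F - {i})"
    using X by (subst sum.remove[of ?F i]) auto
  moreover have "q ^ k dvd sum f (?F - {i})"
    using X dvd by (intro dvd_sum) auto
  ultimately have "q ^ k dvd sum f ?F - f i" by simp
  moreover have "\<forall>n\<in>{..<k}. fps_nth (sum f ?F) n = fps_nth S n"
    using nth[rule_format, of ?F] X i by blast
  ultimately show ?thesis
    unfolding q_power_dvd_iff by simp
qed

section \<open>Functional equations for the triple series\<close>

abbreviation exponent :: "nat \<Rightarrow> nat \<Rightarrow> nat \<Rightarrow> nat" where
  "exponent n1 n2 n3 \<equiv>
     3 * (n1 choose 2) + (n2 choose 2) + (n3 choose 2) + n1 * n2 + n2 * n3 + n3 * n1"

text \<open>With inverses in place of a quotient, terms become plain products that can be rearranged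
  by commutativity.\<close>

definition inv_poch :: "nat \<Rightarrow> series" where
  "inv_poch n = inverse (qpoch (q\<^sup>2) (q\<^sup>2) n)"

lemma inv_poch_right: "qpoch (q\<^sup>2) (q\<^sup>2) n * inv_poch n = 1"
proof -
  let ?g = "qpoch (q\<^sup>2) (q\<^sup>2) n"
  have "1 / ?g = inv_poch n"
    unfolding inv_poch_def by (subst fps_divide_unit) (simp_all add: qpoch_q2_nth_0)
  then show ?thesis
    using series_divide_mult_cancel[of ?g 1] qpoch_q2_nth_0 by (simp add: mult.commute)
qed

lemma inv_poch_0: "inv_poch 0 = 1"
  using inv_poch_right[of 0] by (simp add: qpoch_def)

lemma inv_poch_Suc: "inv_poch (Suc n) * (1 - q ^ (2 * Suc n)) = inv_poch n"
proof -
  let ?g = "qpoch (q\<^sup>2) (q\<^sup>2) n"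
  have g: "qpoch (q\<^sup>2) (q\<^sup>2) (Suc n) = ?g * (1 - q ^ (2 * Suc n))"
    by (simp add: qpoch_def flip: power_mult power_add)
  have "inv_poch n = inv_poch n * (qpoch (q\<^sup>2) (q\<^sup>2) (Suc n) * inv_poch (Suc n))"
    by (simp only: inv_poch_right mult_1_right)
  also have "\<dots> = (?g * inv_poch n) * (inv_poch (Suc n) * (1 - q ^ (2 * Suc n)))"
    unfolding g by (simp only: mult_ac)
  finally show ?thesis by (simp only: inv_poch_right mult_1_left)
qed

text \<open>
  \<open>T_term\<close> without the last factor of \<open>(-q;q)\<^sub>N\<close>, where \<open>N = n\<^sub>1 + n\<^sub>2 + n\<^sub>3\<close>. At \<open>N = 0\<close> the truncated
  \<open>N - 1\<close> makes it 1 instead of half of \<open>T_term\<close>; there it only occurs multiplied by 0.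
\<close>

definition reduced_term :: "series \<Rightarrow> series \<Rightarrow> series \<Rightarrow> nat \<Rightarrow> nat \<Rightarrow> nat \<Rightarrow> series" where
  "reduced_term a b c n1 n2 n3 =
     q ^ exponent n1 n2 n3 * a ^ n1 * b ^ n2 * c ^ n3 * qpoch (- q) q (n1 + n2 + n3 - 1) *
     inv_poch n1 * inv_poch n2 * inv_poch n3"

lemma T_term_eq:
  "T_term a b c n1 n2 n3 =
     q ^ exponent n1 n2 n3 * a ^ n1 * b ^ n2 * c ^ n3 * qpoch (- q) q (n1 + n2 + n3) *
     inv_poch n1 * inv_poch n2 * inv_poch n3"
proof -
  let ?g = "\<lambda>n. qpoch (q\<^sup>2) (q\<^sup>2) n"
  have "f / (?g n1 * ?g n2 * ?g n3) = f * (inv_poch n1 * inv_poch n2 * inv_poch n3)" for f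
  proof -
    have "?g n1 * ?g n2 * ?g n3 * (inv_poch n1 * inv_poch n2 * inv_poch n3)
        = (?g n1 * inv_poch n1) * (?g n2 * inv_poch n2) * (?g n3 * inv_poch n3)"
      by (simp only: mult_ac)
    also have "\<dots> = 1" by (simp only: inv_poch_right mult_1_right)
    finally have 1: "?g n1 * ?g n2 * ?g n3 * (inv_poch n1 * inv_poch n2 * inv_poch n3) = 1" .
    have "fps_nth (?g n1 * ?g n2 * ?g n3) 0 = 1"
      by (simp only: fps_mult_nth_0 qpoch_q2_nth_0 mult_1_right)
    from series_divide_mult_cancel[OF this, of f]
    have "f / (?g n1 * ?g n2 * ?g n3) * (?g n1 * ?g n2 * ?g n3)
        * (inv_poch n1 * inv_poch n2 * inv_poch n3)
        = f * (inv_poch n1 * inv_poch n2 * inv_poch n3)"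
      by (rule arg_cong)
    then show ?thesis by (simp only: mult.assoc[of "f / _"] 1 mult_1_right)
  qed
  then show ?thesis unfolding T_term_def by (simp only: mult_ac)
qed

lemma T_term_reduced:
  "n1 + n2 + n3 \<noteq> 0 \<Longrightarrow>
     T_term a b c n1 n2 n3 = (1 + q ^ (n1 + n2 + n3)) * reduced_term a b c n1 n2 n3"
proof -
  assume "n1 + n2 + n3 \<noteq> 0"
  then obtain m where m: "n1 + n2 + n3 = Suc m" using not0_implies_Suc by blast
  have "qpoch (- q) q (Suc m) = qpoch (- q) q m * (1 + q ^ Suc m)"
    by (simp add: qpoch_def)
  then show ?thesis unfolding T_term_eq reduced_term_def m by (simp add: mult_ac)
qed

section \<open>Recurrences of the terms in each summation index\<close>

lemma choose_two_Suc: "(Suc n choose 2) = (n choose 2) + n"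
  by (simp add: numeral_2_eq_2)

text \<open>The factor 1 - q^(2(n1+1)) cancels the last factor of (q^2;q^2)_(n1+1), and the
  shortened Pochhammer symbol at N + 1 is the full (-q;q)_N, so \<open>T_term\<close> appears. The
  power of \<open>q\<close> is the increment of \<open>exponent\<close>; raising \<open>n2\<close>
  or \<open>n3\<close> instead gives n1 + n2 + n3.\<close>

lemma reduced_term_Suc1:
  "reduced_term a b c (Suc n1) n2 n3 * (1 - q ^ (2 * Suc n1))
     = a * q ^ (3 * n1 + n2 + n3) * T_term a b c n1 n2 n3"
proof -
  have e: "exponent (Suc n1) n2 n3 = exponent n1 n2 n3 + (3 * n1 + n2 + n3)"
    by (simp add: choose_two_Suc algebra_simps)
  show ?thesis
    unfolding reduced_term_def T_term_eq e inv_poch_Suc[of n1, symmetric]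
    by (simp add: power_add mult_ac del: mult_Suc_right)
qed

lemma reduced_term_Suc2:
  "reduced_term a b c n1 (Suc n2) n3 * (1 - q ^ (2 * Suc n2))
     = b * q ^ (n1 + n2 + n3) * T_term a b c n1 n2 n3"
proof -
  have e: "exponent n1 (Suc n2) n3 = exponent n1 n2 n3 + (n1 + n2 + n3)"
    by (simp add: choose_two_Suc algebra_simps)
  show ?thesis
    unfolding reduced_term_def T_term_eq e inv_poch_Suc[of n2, symmetric]
    by (simp add: power_add mult_ac del: mult_Suc_right)
qed

lemma reduced_term_Suc3:
  "reduced_term a b c n1 n2 (Suc n3) * (1 - q ^ (2 * Suc n3))
     = c * q ^ (n1 + n2 + n3) * T_term a b c n1 n2 n3"
proof -
  have e: "exponent n1 n2 (Suc n3) = exponent n1 n2 n3 + (n1 + n2 + n3)"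
    by (simp add: choose_two_Suc algebra_simps)
  show ?thesis
    unfolding reduced_term_def T_term_eq e inv_poch_Suc[of n3, symmetric]
    by (simp add: power_add mult_ac del: mult_Suc_right)
qed

section \<open>Scaling the variables, shifting the indices, and the resulting equations for
  \<open>T\<close>\<close>

lemma T_term_scale:
  "T_term (a * q ^ i) (b * q ^ j) (c * q ^ k) n1 n2 n3
     = q ^ (i * n1 + j * n2 + k * n3) * T_term a b c n1 n2 n3"
  unfolding T_term_eq by (simp add: power_mult_distrib power_add power_mult mult_ac)

lemma T_has_sum: "((\<lambda>(n1, n2, n3). T_term a b c n1 n2 n3) has_sum T a b c) UNIV"
  unfolding T_def by (rule has_sum_infsum[OF T_summable])

lemma has_sum_scaled_T:
  "((\<lambda>(n1, n2, n3). q ^ (i * n1 + j * n2 + k * n3) * T_term a b c n1 n2 n3)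
     has_sum T (a * q ^ i) (b * q ^ j) (c * q ^ k)) UNIV"
  using T_has_sum[of "a * q ^ i" "b * q ^ j" "c * q ^ k"] by (simp only: T_term_scale)

lemma has_sum_inj_zero_extend:
  fixes f :: "'a \<Rightarrow> 'b::{comm_monoid_add, topological_space}"
  assumes "inj h" "\<And>x. x \<notin> range h \<Longrightarrow> f x = 0" "((\<lambda>x. f (h x)) has_sum S) UNIV"
  shows "(f has_sum S) UNIV"
proof -
  have "(f has_sum S) (range h)"
    using assms(3) has_sum_reindex[OF assms(1), of f S] by (simp add: o_def)
  then show ?thesis
    using has_sum_cong_neutral[of UNIV "range h" f f S] assms(2) by auto
qed

text \<open>Meant for terms with the factor 1 - q^(2 n1), which vanish at n1 = 0.\<close>

lemma has_sum_shift1: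
  assumes "\<And>n2 n3. f (0, n2, n3) = 0"
    and "((\<lambda>(n1, n2, n3). f (Suc n1, n2, n3)) has_sum S) UNIV"
  shows "(f has_sum S) UNIV"
proof (rule has_sum_inj_zero_extend[where h = "\<lambda>(n1, n2, n3). (Suc n1, n2, n3)"])
  show "f x = 0" if "x \<notin> range (\<lambda>(n1, n2, n3). (Suc n1, n2, n3))" for x
  proof (cases x)
    case (fields n1 n2 n3)
    with that assms(1) show ?thesis by (cases n1) (force simp: image_iff)+
  qed
qed (use assms(2) in \<open>auto simp: inj_def case_prod_unfold\<close>)

lemma has_sum_shift2:
  assumes "\<And>n1 n3. f (n1, 0, n3) = 0"
    and "((\<lambda>(n1, n2, n3). f (n1, Suc n2, n3)) has_sum S) UNIV"
  shows "(f has_sum S) UNIV"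
proof (rule has_sum_inj_zero_extend[where h = "\<lambda>(n1, n2, n3). (n1, Suc n2, n3)"])
  show "f x = 0" if "x \<notin> range (\<lambda>(n1, n2, n3). (n1, Suc n2, n3))" for x
  proof (cases x)
    case (fields n1 n2 n3)
    with that assms(1) show ?thesis by (cases n2) (force simp: image_iff)+
  qed
qed (use assms(2) in \<open>auto simp: inj_def case_prod_unfold\<close>)

lemma has_sum_shift3:
  assumes "\<And>n1 n2. f (n1, n2, 0) = 0"
    and "((\<lambda>(n1, n2, n3). f (n1, n2, Suc n3)) has_sum S) UNIV"
  shows "(f has_sum S) UNIV"
proof (rule has_sum_inj_zero_extend[where h = "\<lambda>(n1, n2, n3). (n1, n2, Suc n3)"])
  show "f x = 0" if "x \<notin> range (\<lambda>(n1, n2, n3). (n1, n2, Suc n3))" for x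
  proof (cases x)
    case (fields n1 n2 n3)
    with that assms(1) show ?thesis by (cases n3) (force simp: image_iff)+
  qed
qed (use assms(2) in \<open>auto simp: inj_def case_prod_unfold\<close>)

text \<open>The difference of the two series without prefactor has the terms (1 - q^(2 n3))
  \<open>T_term\<close>. Raising \<open>n3\<close> by one turns them into (1 + q^(N+1)) c q^N
  \<open>T_term\<close>, where N = n1 + n2 + n3, and the two summands of 1 + q^(N+1) give the
  remaining two series.\<close>

lemma T_eq_shift3:
  "T a b c = T a b (c * q\<^sup>2) + c * T (a * q) (b * q) (c * q)
     + c * q * T (a * q\<^sup>2) (b * q\<^sup>2) (c * q\<^sup>2)"
proof -
  let ?f = "\<lambda>(n1, n2, n3). (1 + q ^ (n1 + n2 + n3)) *
     (reduced_term a b c n1 n2 n3 * (1 - q ^ (2 * n3)))"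
  have "(?f has_sum c * T (a * q ^ 1) (b * q ^ 1) (c * q ^ 1)
     + c * q * T (a * q\<^sup>2) (b * q\<^sup>2) (c * q\<^sup>2)) UNIV"
  proof (rule has_sum_shift3, goal_cases)
    case 2
    have "((\<lambda>n. c * (case n of (n1, n2, n3) \<Rightarrow> q ^ (1*n1+1*n2+1*n3) * T_term a b c n1 n2 n3)
      + c * q * (case n of (n1, n2, n3) \<Rightarrow> q ^ (2*n1+2*n2+2*n3) * T_term a b c n1 n2 n3))
      has_sum (c * T (a * q ^ 1) (b * q ^ 1) (c * q ^ 1)
        + c * q * T (a * q\<^sup>2) (b * q\<^sup>2) (c * q\<^sup>2))) UNIV"
      by (intro has_sum_add has_sum_cmult_right has_sum_scaled_T)
    then show ?case
      by (rule has_sum_cong[THEN iffD1, rotated])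
        (auto simp only: prod.case reduced_term_Suc3 split: prod.splits,
         simp add: algebra_simps power_add power_mult power2_eq_square)
  qed simp
  moreover have "((\<lambda>n. (case n of (n1, n2, n3) \<Rightarrow> q ^ (0*n1+0*n2+2*n3) * T_term a b c n1 n2 n3) + ?f n)
     has_sum T a b c) UNIV"
  proof (rule has_sum_cong[THEN iffD1, OF _ T_has_sum[of a b c]])
    fix n :: "nat \<times> nat \<times> nat"
    obtain n1 n2 n3 where n: "n = (n1, n2, n3)" by (cases n)
    show "(case n of (n1, n2, n3) \<Rightarrow> T_term a b c n1 n2 n3) =
       (case n of (n1, n2, n3) \<Rightarrow> q ^ (0*n1+0*n2+2*n3) * T_term a b c n1 n2 n3) + ?f n"
      by (cases "n1 + n2 + n3 = 0") (auto simp: n T_term_reduced algebra_simps)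
  qed
  ultimately have "T a b c = T (a * q ^ 0) (b * q ^ 0) (c * q\<^sup>2) + (c * T (a * q ^ 1) (b * q ^ 1) (c * q ^ 1)
     + c * q * T (a * q\<^sup>2) (b * q\<^sup>2) (c * q\<^sup>2))"
    by (intro has_sum_unique[OF _ has_sum_add[OF has_sum_scaled_T]])
  then show ?thesis by (simp add: add.assoc)
qed

text \<open>The exponent, the Pochhammer symbol and the denominator are symmetric in
  \<open>n2\<close> and \<open>n3\<close>.\<close>

lemma T_swap: "T a b c = T a c b"
proof -
  have "T_term a b c n1 n2 n3 = T_term a c b n1 n3 n2" for n1 n2 n3
    unfolding T_term_eq by (simp add: mult_ac add_ac)
  then have "((\<lambda>(n1, n2, n3). T_term a c b n1 n3 n2) has_sum T a b c) UNIV"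
    using T_has_sum[of a b c] by (simp only:)
  moreover have "bij (\<lambda>(n1, n2, n3). (n1 :: nat, n3 :: nat, n2 :: nat))"
    by (rule involuntory_imp_bij) auto
  from has_sum_reindex_bij_betw[OF this, of "\<lambda>(n1, n2, n3). T_term a c b n1 n2 n3" "T a b c"]
  have "((\<lambda>(n1, n2, n3). T_term a c b n1 n3 n2) has_sum T a b c) UNIV
     \<longleftrightarrow> ((\<lambda>(n1, n2, n3). T_term a c b n1 n2 n3) has_sum T a b c) UNIV"
    by (simp add: case_prod_unfold)
  ultimately show ?thesis
    by (intro has_sum_unique[OF _ T_has_sum]) (simp only:)
qed

lemma T_eq_shift2:
  "T a b c = T a (b * q\<^sup>2) c + b * T (a * q) (b * q) (c * q)
     + b * q * T (a * q\<^sup>2) (b * q\<^sup>2) (c * q\<^sup>2)"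
  unfolding T_swap[of a b c] T_swap[of a "b * q\<^sup>2" c] T_swap[of "a * q" "b * q" "c * q"]
    T_swap[of "a * q\<^sup>2" "b * q\<^sup>2" "c * q\<^sup>2"]
  by (rule T_eq_shift3)

text \<open>Once the series with prefactors are shifted by one index, all terms at a nonzero index
  are multiples of the same \<open>reduced_term\<close>, and the claim becomes a polynomial identity
  in q^n1, q^n2, q^n3.\<close>

lemma T_eq_mixed:
  "T a b (c * q) + c * T (a * q\<^sup>2) (b * q\<^sup>2) (c * q)
     = T (a * q) (b * q) c + (a + b) * T (a * q ^ 3) (b * q) (c * q\<^sup>2)"
proof -
  let ?t = "T_term a b c" and ?r = "reduced_term a b c"
  let ?u = "\<lambda>i j k (n1, n2, n3). q ^ (i * n1 + j * n2 + k * n3) * ?t n1 n2 n3"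
  \<comment> \<open>The leading powers of \<open>q\<close> complete the increments of
    \<open>exponent\<close> after the shift: to 3 n1 + n2 + 2 n3 for \<open>?f1\<close> and
    \<open>?f2\<close>, and to 2 n1 + 2 n2 + n3 for \<open>?f3\<close>.\<close>
  let ?f1 = "\<lambda>(n1, n2, n3). q ^ n3 * (?r n1 n2 n3 * (1 - q ^ (2 * n1)))"
  let ?f2 = "\<lambda>(n1, n2, n3). q ^ (2 * n1 + n3) * (?r n1 n2 n3 * (1 - q ^ (2 * n2)))"
  let ?f3 = "\<lambda>(n1, n2, n3). q ^ (n1 + n2) * (?r n1 n2 n3 * (1 - q ^ (2 * n3)))"
  have u: "(?u i j k has_sum T (a * q ^ i) (b * q ^ j) (c * q ^ k)) UNIV" for i j k
    by (rule has_sum_scaled_T)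
  have f1: "(?f1 has_sum a * T (a * q ^ 3) (b * q ^ 1) (c * q\<^sup>2)) UNIV"
  proof (rule has_sum_shift1, goal_cases)
    case 2
    show ?case
      by (rule has_sum_cong[THEN iffD1, OF _ has_sum_cmult_right[OF u]])
        (clarsimp simp only: prod.case reduced_term_Suc1,
         simp add: algebra_simps power_add power_mult power2_eq_square)
  qed simp
  have f2: "(?f2 has_sum b * T (a * q ^ 3) (b * q ^ 1) (c * q\<^sup>2)) UNIV"
  proof (rule has_sum_shift2, goal_cases)
    case 2
    show ?case
      by (rule has_sum_cong[THEN iffD1, OF _ has_sum_cmult_right[OF u]])
        (clarsimp simp only: prod.case reduced_term_Suc2,
         simp add: algebra_simps power_add power_mult power2_eq_square power3_eq_cube power_mult_distrib)
  qed simp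
  have f3: "(?f3 has_sum c * T (a * q\<^sup>2) (b * q\<^sup>2) (c * q ^ 1)) UNIV"
  proof (rule has_sum_shift3, goal_cases)
    case 2
    show ?case
      by (rule has_sum_cong[THEN iffD1, OF _ has_sum_cmult_right[OF u]])
        (clarsimp simp only: prod.case reduced_term_Suc3,
         simp add: algebra_simps power_add power_mult power2_eq_square power_mult_distrib)
  qed simp
  have "?u 0 0 1 n + ?f3 n = ?u 1 1 0 n + (?f1 n + ?f2 n)" for n
  proof -
    obtain n1 n2 n3 where n: "n = (n1, n2, n3)" by (cases n)
    define x y z where "x = q ^ n1" and "y = q ^ n2" and "z = q ^ n3"
    show ?thesis
    proof (cases "n1 + n2 + n3 = 0")
      case False
      \<comment> \<open>Both sides expand to z + x y.\<close>
      have "z * (1 + x * y * z) + x * y * (1 - z * z)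
          = x * y * (1 + x * y * z) + (z * (1 - x * x) + x * x * z * (1 - y * y))"
        by (simp add: algebra_simps)
      from arg_cong[OF this, of "\<lambda>w. w * ?r n1 n2 n3"] False show ?thesis
        by (simp add: n T_term_reduced x_def y_def z_def power_add power_mult power2_eq_square algebra_simps)
    qed (auto simp: n)
  qed
  then have eq: "(\<lambda>n. ?u 0 0 1 n + ?f3 n) = (\<lambda>n. ?u 1 1 0 n + (?f1 n + ?f2 n))"
    by (rule ext)
  have "T (a * q ^ 0) (b * q ^ 0) (c * q ^ 1) + c * T (a * q\<^sup>2) (b * q\<^sup>2) (c * q ^ 1)
     = T (a * q ^ 1) (b * q ^ 1) (c * q ^ 0)
      + (a * T (a * q ^ 3) (b * q ^ 1) (c * q\<^sup>2) + b * T (a * q ^ 3) (b * q ^ 1) (c * q\<^sup>2))"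
    using has_sum_add[OF u[of 0 0 1] f3] has_sum_add[OF u[of 1 1 0] has_sum_add[OF f1 f2]]
    unfolding eq by (rule has_sum_unique)
  then show ?thesis
    by (simp only: power_0 power_one_right mult_1_right distrib_right)
qed

section \<open>Removing the part of size one\<close>

text \<open>The decrease by 1 is used in the opposite direction: \<open>lift\<close> is injective,
  so sums can be reindexed along it.\<close>

definition lift :: "cpart multiset \<Rightarrow> cpart multiset" where
  "lift \<mu> = image_mset (\<lambda>(j, c). (Suc j, c)) \<mu>"

text \<open>The parts excluded by \<open>1\<^sub>c\<close>, after the decrease by 1.\<close>

definition next_avoid :: "color \<Rightarrow> cpart set" where
  "next_avoid c = (if c = B then {(1, R), (1, G)} else {(1, R), (2, R), (1, B)})"

text \<open>What \<open>S\<close> demands of the parts of size at least 2, after the decrease; its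
  parts of size 1 only restrict the color of the removed part.\<close>

definition lower :: "cpart set \<Rightarrow> cpart set" where
  "lower S = {(j, c). j \<ge> 1 \<and> (Suc j, c) \<in> S}"

lemma inj_lift: "inj lift"
  unfolding lift_def by (rule multiset.inj_map) (auto simp: inj_def)

lemma in_lift_iff: "(j, c) \<in># lift \<mu> \<longleftrightarrow> (\<exists>i. j = Suc i \<and> (i, c) \<in># \<mu>)"
  by (force simp: lift_def image_iff)

lemma filter_size_lift:
  "size {#p \<in># lift \<mu>. fst p = j#} = (case j of 0 \<Rightarrow> 0 | Suc i \<Rightarrow> size {#p \<in># \<mu>. fst p = i#})"
  by (cases j) (simp_all add: lift_def filter_mset_image_mset case_prod_unfold)

lemma forbidden_pairs_iff:
  "((i, c), (k, d)) \<in> forbidden_pairs \<longleftrightarrow> i \<ge> 1 \<and>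
     (k = i + 1 \<and> (c, d) \<in> {(R, R), (R, B), (G, R), (G, B), (B, R), (B, G)} \<or>
      k = i + 2 \<and> (c, d) \<in> {(R, R), (G, R)})"
  unfolding forbidden_pairs_def by auto

lemma Lam_iff:
  "\<mu> \<in> Lam \<longleftrightarrow> three_colored_partition \<mu> \<and> (\<forall>j. size {#p \<in># \<mu>. fst p = j#} \<le> 1) \<and>
     (\<forall>i c k d. ((i, c), (k, d)) \<in> forbidden_pairs \<longrightarrow> \<not> ((i, c) \<in># \<mu> \<and> (k, d) \<in># \<mu>))"
  unfolding Lam_def by auto

lemma three_colored_partition_pos: "three_colored_partition \<mu> \<Longrightarrow> (j, c) \<in># \<mu> \<Longrightarrow> j \<ge> 1"
  unfolding three_colored_partition_def by auto

lemma forbidden_pairs_Suc_iff: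
  "i \<ge> 1 \<Longrightarrow> ((Suc i, c), (Suc k, d)) \<in> forbidden_pairs \<longleftrightarrow> ((i, c), (k, d)) \<in> forbidden_pairs"
  by (auto simp: forbidden_pairs_iff)

text \<open>For positive sizes, whether a pair is forbidden depends only on the colors and the
  difference of the sizes, so an increase by 1 changes nothing.\<close>

lemma lift_in_Lam_iff:
  assumes "three_colored_partition \<mu>"
  shows "lift \<mu> \<in> Lam \<longleftrightarrow> \<mu> \<in> Lam"
proof -
  have "three_colored_partition (lift \<mu>)"
    by (auto simp: three_colored_partition_def lift_def)
  moreover have "(\<forall>j. size {#p \<in># lift \<mu>. fst p = j#} \<le> 1) \<longleftrightarrow>
      (\<forall>j. size {#p \<in># \<mu>. fst p = j#} \<le> 1)"
    unfolding filter_size_lift by (auto split: nat.splits)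
  moreover have "(\<forall>i c k d. ((i, c), (k, d)) \<in> forbidden_pairs \<longrightarrow>
        \<not> ((i, c) \<in># lift \<mu> \<and> (k, d) \<in># lift \<mu>)) \<longleftrightarrow>
      (\<forall>i c k d. ((i, c), (k, d)) \<in> forbidden_pairs \<longrightarrow> \<not> ((i, c) \<in># \<mu> \<and> (k, d) \<in># \<mu>))"
    unfolding in_lift_iff
    using forbidden_pairs_Suc_iff three_colored_partition_pos[OF assms] by blast
  ultimately show ?thesis
    using assms unfolding Lam_iff by blast
qed

lemma forbidden_pairs_1_Suc_iff:
  "k \<ge> 1 \<Longrightarrow> ((1, c), (Suc k, d)) \<in> forbidden_pairs \<longleftrightarrow> (k, d) \<in> next_avoid c"
  by (cases c; cases d) (auto simp: forbidden_pairs_iff next_avoid_def)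

text \<open>The new part can only be the smaller member of a forbidden pair; the possible larger
  members, decreased by 1, are \<open>next_avoid c\<close>.\<close>

lemma add_lift_in_Lam_iff:
  assumes "three_colored_partition \<mu>"
  shows "add_mset (1, c) (lift \<mu>) \<in> Lam \<longleftrightarrow> \<mu> \<in> Lam_avoid (next_avoid c)"
proof -
  have pos: "\<And>j c. (j, c) \<in># \<mu> \<Longrightarrow> j \<ge> 1"
    using three_colored_partition_pos[OF assms] .
  \<comment> \<open>Hence \<open>lift\<close> \<mu> has no part of size 1, and the added part is the
    only one of its size.\<close>
  have empty: "{#p \<in># \<mu>. fst p = 0#} = {#}"
    using pos by (subst set_mset_eq_empty_iff[symmetric]) fastforce
  have "size {#p \<in># add_mset (1, c) (lift \<mu>). fst p = j#} \<le> 1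
      \<longleftrightarrow> size {#p \<in># lift \<mu>. fst p = j#} \<le> 1" for j
    by (cases "j = 1") (simp_all add: filter_size_lift empty)
  moreover have "three_colored_partition (add_mset (1, c) (lift \<mu>))"
    "three_colored_partition (lift \<mu>)"
    by (auto simp: three_colored_partition_def lift_def)
  moreover have "(\<forall>i d k e. ((i, d), (k, e)) \<in> forbidden_pairs \<longrightarrow>
        \<not> ((i, d) \<in># add_mset (1, c) (lift \<mu>) \<and> (k, e) \<in># add_mset (1, c) (lift \<mu>))) \<longleftrightarrow>
      (\<forall>i d k e. ((i, d), (k, e)) \<in> forbidden_pairs \<longrightarrow>
        \<not> ((i, d) \<in># lift \<mu> \<and> (k, e) \<in># lift \<mu>)) \<and> (\<forall>p\<in>next_avoid c. p \<notin># \<mu>)"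
    (is "?l \<longleftrightarrow> ?r1 \<and> ?r2")
  proof (intro iffI conjI)
    assume l: ?l
    then show ?r1 by (simp only: set_mset_add_mset_insert insert_iff) blast
    show ?r2
    proof (intro ballI notI)
      fix p assume p: "p \<in> next_avoid c" "p \<in># \<mu>"
      obtain k d where kd: "p = (k, d)" by (cases p)
      with p pos have "((1, c), (Suc k, d)) \<in> forbidden_pairs"
        using forbidden_pairs_1_Suc_iff by blast
      moreover have "(Suc k, d) \<in># lift \<mu>" using p kd by (simp add: in_lift_iff)
      ultimately show False using l by fastforce
    qed
  next
    assume r: "?r1 \<and> ?r2"
    show ?l
    proof (intro allI impI notI)
      fix i d k e
      assume f: "((i, d), (k, e)) \<in> forbidden_pairs"
        and m: "(i, d) \<in># add_mset (1, c) (lift \<mu>) \<and> (k, e) \<in># add_mset (1, c) (lift \<mu>)"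
      from f have "i \<ge> 1" "k > i" by (auto simp: forbidden_pairs_iff)
      with m have "(k, e) \<in># lift \<mu>" by auto
      then obtain k' where k': "k = Suc k'" "(k', e) \<in># \<mu>" unfolding in_lift_iff by blast
      show False
      proof (cases "(i, d) \<in># lift \<mu>")
        case True
        with r f \<open>(k, e) \<in># lift \<mu>\<close> show False by blast
      next
        case False
        with m have "(i, d) = (1, c)" by simp
        then have "(k', e) \<in> next_avoid c"
          using f k' pos forbidden_pairs_1_Suc_iff by blast
        with r k' show False by blast
      qed
    qed
  qed
  ultimately have "add_mset (1, c) (lift \<mu>) \<in> Lam \<longleftrightarrow>
      lift \<mu> \<in> Lam \<and> (\<forall>p\<in>next_avoid c. p \<notin># \<mu>)"
    unfolding Lam_iff by (simp only: simp_thms conj_assoc)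
  then show ?thesis
    using lift_in_Lam_iff[OF assms] by (simp add: Lam_avoid_def)
qed

lemma Lam_cases:
  assumes "\<nu> \<in> Lam"
  obtains \<mu> where "three_colored_partition \<mu>" "\<nu> = lift \<mu>"
  | \<mu> c where "three_colored_partition \<mu>" "\<nu> = add_mset (1, c) (lift \<mu>)"
proof -
  \<comment> \<open>The sizes kept here are at least 2, so the truncated j - 1 is exact and
    positive.\<close>
  define \<mu> where "\<mu> = image_mset (\<lambda>(j, c). (j - 1, c)) {#p \<in># \<nu>. fst p \<noteq> 1#}"
  have pos: "j \<ge> 1" if "(j, c) \<in># \<nu>" for j c
    using assms that unfolding Lam_iff by (blast intro: three_colored_partition_pos)
  have \<mu>: "three_colored_partition \<mu>"
    using pos unfolding \<mu>_def three_colored_partition_def by force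
  have lift: "lift \<mu> = {#p \<in># \<nu>. fst p \<noteq> 1#}"
  proof -
    have "lift \<mu> = image_mset (\<lambda>p. p) {#p \<in># \<nu>. fst p \<noteq> 1#}"
      unfolding lift_def \<mu>_def multiset.map_comp
      by (rule image_mset_cong) (use pos in \<open>force simp: o_def\<close>)
    then show ?thesis by simp
  qed
  have split: "\<nu> = {#p \<in># \<nu>. fst p = 1#} + lift \<mu>"
    unfolding lift by (rule multiset_partition)
  have "size {#p \<in># \<nu>. fst p = 1#} \<le> 1" using assms unfolding Lam_iff by blast
  then consider "{#p \<in># \<nu>. fst p = 1#} = {#}" | p where "{#p \<in># \<nu>. fst p = 1#} = {#p#}"
    by (metis One_nat_def le_Suc_eq le_zero_eq size_eq_0_iff_empty size_1_singleton_mset)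
  then show thesis
  proof cases
    case 1
    have "\<nu> = lift \<mu>" using split unfolding 1 by (simp only: add_0)
    with \<mu> show thesis by (rule that(1))
  next
    case (2 p)
    then have "p \<in># {#p \<in># \<nu>. fst p = 1#}" by simp
    then have "p = (1, snd p)" by (cases p) simp
    moreover have "\<nu> = add_mset p (lift \<mu>)"
      using split unfolding 2 by simp
    ultimately have "\<nu> = add_mset (1, snd p) (lift \<mu>)" by (simp only:)
    with \<mu> show thesis by (rule that(2))
  qed
qed

lemma lift_avoids_iff:
  assumes "three_colored_partition \<mu>"
  shows "(\<forall>p\<in>S. p \<notin># lift \<mu>) \<longleftrightarrow> (\<forall>p\<in>lower S. p \<notin># \<mu>)"
  using three_colored_partition_pos[OF assms] by (force simp: lower_def in_lift_iff)

lemma Lam_avoid_imp_three_colored: "\<mu> \<in> Lam_avoid S \<Longrightarrow> three_colored_partition \<mu>"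
  unfolding Lam_avoid_def Lam_iff by blast

text \<open>A partition has no part of size 1, or exactly one, of a color that \<open>S\<close>
  permits; in the second case the rest obeys both \<open>next_avoid c\<close> and
  \<open>lower S\<close>.\<close>

lemma Lam_avoid_decompose:
  "Lam_avoid S = lift ` Lam_avoid (lower S) \<union>
     (\<Union>c\<in>{c. (1, c) \<notin> S}. (\<lambda>\<mu>. add_mset (1, c) (lift \<mu>)) ` Lam_avoid (next_avoid c \<union> lower S))"
  (is "_ = ?r")
proof (intro equalityI subsetI)
  fix \<nu> assume \<nu>: "\<nu> \<in> Lam_avoid S"
  then have "\<nu> \<in> Lam" by (simp add: Lam_avoid_def)
  then show "\<nu> \<in> ?r"
  proof (cases rule: Lam_cases)
    case (1 \<mu>)
    then have "\<mu> \<in> Lam_avoid (lower S)"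
      using \<nu> lift_in_Lam_iff lift_avoids_iff[of \<mu> S] by (simp add: Lam_avoid_def)
    with 1 show ?thesis by blast
  next
    case (2 \<mu> c)
    then have "\<mu> \<in> Lam_avoid (next_avoid c)"
      using \<nu> add_lift_in_Lam_iff by (simp add: Lam_avoid_def)
    moreover have "\<forall>p\<in>S. p \<notin># lift \<mu>" "(1, c) \<notin> S"
      using \<nu> 2 by (auto simp: Lam_avoid_def)
    ultimately have "\<mu> \<in> Lam_avoid (next_avoid c \<union> lower S)"
      using lift_avoids_iff[OF 2(1), of S] by (auto simp: Lam_avoid_def)
    with 2 \<open>(1, c) \<notin> S\<close> show ?thesis by blast
  qed
next
  fix \<nu> assume "\<nu> \<in> ?r"
  then consider \<mu> where "\<nu> = lift \<mu>" "\<mu> \<in> Lam_avoid (lower S)"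
    | \<mu> c where "(1, c) \<notin> S" "\<nu> = add_mset (1, c) (lift \<mu>)"
      "\<mu> \<in> Lam_avoid (next_avoid c \<union> lower S)"
    by blast
  then show "\<nu> \<in> Lam_avoid S"
  proof cases
    case (1 \<mu>)
    then show ?thesis
      using lift_in_Lam_iff[of \<mu>] lift_avoids_iff[of \<mu> S] Lam_avoid_imp_three_colored
      by (auto simp: Lam_avoid_def)
  next
    case (2 \<mu> c)
    have t: "three_colored_partition \<mu>" using 2 Lam_avoid_imp_three_colored by blast
    have "\<mu> \<in> Lam_avoid (next_avoid c)" "\<forall>p\<in>lower S. p \<notin># \<mu>"
      using 2 by (auto simp: Lam_avoid_def)
    then show ?thesis
      using add_lift_in_Lam_iff[OF t, of c] lift_avoids_iff[OF t, of S] 2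
      by (auto simp: Lam_avoid_def)
  qed
qed

section \<open>From the decomposition to a recursion for generating functions\<close>

definition part_var :: "series \<Rightarrow> series \<Rightarrow> series \<Rightarrow> color \<Rightarrow> series" where
  "part_var a b c d = (case d of R \<Rightarrow> a | G \<Rightarrow> b | B \<Rightarrow> c)"

definition monomial :: "series \<Rightarrow> series \<Rightarrow> series \<Rightarrow> cpart multiset \<Rightarrow> series" where
  "monomial a b c \<mu> = a ^ len R \<mu> * b ^ len G \<mu> * c ^ len B \<mu> * q ^ weight \<mu>"

lemma len_simps [simp]:
  "len d {#} = 0"
  "len d (add_mset p \<mu>) = (if snd p = d then Suc (len d \<mu>) else len d \<mu>)"
  by (simp_all add: len_def)

lemma weight_simps [simp]: "weight {#} = 0" "weight (add_mset p \<mu>) = fst p + weight \<mu>"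
  by (simp_all add: weight_def)

lemma lift_simps [simp]:
  "lift {#} = {#}"
  "lift (add_mset (j, d) \<mu>) = add_mset (Suc j, d) (lift \<mu>)"
  by (simp_all add: lift_def)

lemma monomial_empty: "monomial a b c {#} = 1"
  by (simp add: monomial_def)

lemma monomial_add_mset:
  "monomial a b c (add_mset (j, d) \<mu>) = part_var a b c d * q ^ j * monomial a b c \<mu>"
  by (cases d) (simp_all add: monomial_def part_var_def power_add mult_ac)

text \<open>Every part gains one unit of weight, so the variable of its color picks up one
  \<open>q\<close>.\<close>

lemma monomial_lift: "monomial a b c (lift \<mu>) = monomial (a * q) (b * q) (c * q) \<mu>"
proof (induction \<mu>)
  case (add p \<mu>)
  then show ?case
    by (cases p; cases "snd p") (simp_all add: monomial_add_mset part_var_def mult_ac)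
qed (simp add: monomial_empty)

lemma GF_has_sum: "(monomial a b c has_sum GF (Lam_avoid S) a b c) (Lam_avoid S)"
  unfolding GF_def monomial_def[abs_def]
  by (rule has_sum_infsum, rule GF_summable) (auto simp: Lam_avoid_def)

lemma finite_colors: "finite (D :: color set)"
proof (rule finite_subset)
  show "D \<subseteq> {R, G, B}" using color.exhaust by blast
qed simp

lemma has_sum_UN_disjoint:
  fixes f :: "'a \<Rightarrow> 'b::topological_comm_monoid_add"
  assumes "finite I" "\<And>i. i \<in> I \<Longrightarrow> (f has_sum S i) (A i)"
    and "\<And>i j. i \<in> I \<Longrightarrow> j \<in> I \<Longrightarrow> i \<noteq> j \<Longrightarrow> A i \<inter> A j = {}"
  shows "(f has_sum (\<Sum>i\<in>I. S i)) (\<Union>i\<in>I. A i)"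
  using assms
proof (induction I rule: finite_induct)
  case (insert i I)
  have "(f has_sum (\<Sum>i\<in>I. S i)) (\<Union>i\<in>I. A i)"
    by (rule insert.IH) (use insert.prems in auto)
  moreover have "A i \<inter> (\<Union>i\<in>I. A i) = {}"
    using insert.prems(2)[of i] insert.hyps(2) by blast
  ultimately show ?case
    using has_sum_Un_disjoint[OF insert.prems(1)[of i]] insert.hyps by simp
qed simp

text \<open>The pieces of \<open>Lam_avoid_decompose\<close> are disjoint, being told apart by the
  part of size 1; each is summed by reindexing along \<open>lift\<close>.\<close>

lemma GF_recursion:
  "GF (Lam_avoid S) a b c = GF (Lam_avoid (lower S)) (a * q) (b * q) (c * q) +
     (\<Sum>d\<in>{d. (1, d) \<notin> S}. part_var a b c d * q *
        GF (Lam_avoid (next_avoid d \<union> lower S)) (a * q) (b * q) (c * q))"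
proof -
  let ?L = "\<lambda>d. Lam_avoid (next_avoid d \<union> lower S)"
  let ?add = "\<lambda>d \<mu>. add_mset (1 :: nat, d) (lift \<mu>)"
  have no1: "\<nu> \<noteq> ?add d \<mu>" if "\<nu> \<in> lift ` Lam_avoid T" for T \<nu> d \<mu>
  proof -
    from that obtain \<rho> where \<rho>: "\<nu> = lift \<rho>" "three_colored_partition \<rho>"
      using Lam_avoid_imp_three_colored by blast
    have "(1, d) \<notin># \<nu>"
      using three_colored_partition_pos[OF \<rho>(2), of 0] unfolding \<rho> in_lift_iff by auto
    then show ?thesis by auto
  qed
  have inj: "inj_on (?add d) X" for d X
    using inj_lift by (auto simp: inj_on_def)
  have "(monomial a b c has_sum GF (Lam_avoid (lower S)) (a * q) (b * q) (c * q))
      (lift ` Lam_avoid (lower S))"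
    using GF_has_sum[of "a * q" "b * q" "c * q" "lower S"]
    by (subst has_sum_reindex)
      (auto simp: o_def monomial_lift intro: inj_on_subset[OF inj_lift])
  moreover have "(monomial a b c has_sum
      part_var a b c d * q * GF (?L d) (a * q) (b * q) (c * q)) (?add d ` ?L d)" for d
    using has_sum_cmult_right[OF GF_has_sum, of "part_var a b c d * q" "a * q" "b * q" "c * q"]
    by (subst has_sum_reindex[OF inj]) (simp add: o_def monomial_add_mset monomial_lift)
  then have "(monomial a b c has_sum (\<Sum>d\<in>{d. (1, d) \<notin> S}. part_var a b c d * q *
        GF (?L d) (a * q) (b * q) (c * q))) (\<Union>d\<in>{d. (1, d) \<notin> S}. ?add d ` ?L d)"
  proof (intro has_sum_UN_disjoint finite_colors)
    fix d e :: color assume "d \<noteq> e"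
    have "?add d \<mu> \<noteq> ?add e \<mu>'" if "\<mu> \<in> ?L d" "\<mu>' \<in> ?L e" for \<mu> \<mu>'
    proof
      assume eq: "?add d \<mu> = ?add e \<mu>'"
      then have "(1, d) \<in># add_mset (1, e) (lift \<mu>')" by (metis union_single_eq_member)
      \<comment> \<open>A part of size 1 in a lift would come from a part of size 0.\<close>
      with \<open>d \<noteq> e\<close> have "(0, d) \<in># \<mu>'" by (simp add: in_lift_iff)
      with three_colored_partition_pos[OF Lam_avoid_imp_three_colored[OF that(2)]]
      have "(1 :: nat) \<le> 0" by blast
      then show False by simp
    qed
    then show "?add d ` ?L d \<inter> ?add e ` ?L e = {}" by blast
  qed
  ultimately have "(monomial a b c has_sum
      (GF (Lam_avoid (lower S)) (a * q) (b * q) (c * q) +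
      (\<Sum>d\<in>{d. (1, d) \<notin> S}. part_var a b c d * q * GF (?L d) (a * q) (b * q) (c * q))))
      (Lam_avoid S)"
    unfolding Lam_avoid_decompose[of S] using no1 by (intro has_sum_Un_disjoint) blast+
  then show ?thesis
    by (rule has_sum_unique[OF GF_has_sum])
qed

section \<open>Comparing the two systems of recursions\<close>

text \<open>The empty partition contributes 1, and the monomial of any other contains at least one
  of the three variables.\<close>

lemma q_power_dvd_GF:
  assumes "q ^ k dvd a" "q ^ k dvd b" "q ^ k dvd c"
  shows "q ^ k dvd GF (Lam_avoid S) a b c - 1"
proof -
  have "q ^ k dvd monomial a b c \<mu>" if "\<mu> \<noteq> {#}" for \<mu>
  proof -
    from that obtain j d \<nu> where "\<mu> = add_mset (j, d) \<nu>"
      by (metis multiset_cases surj_pair)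
    moreover have "q ^ k dvd part_var a b c d"
      using assms by (cases d) (simp_all add: part_var_def)
    ultimately show ?thesis by (simp add: monomial_add_mset)
  qed
  moreover have "{#} \<in> Lam_avoid S"
    by (simp add: Lam_avoid_def Lam_iff three_colored_partition_def)
  ultimately show ?thesis
    using q_power_dvd_has_sum_diff[OF GF_has_sum, of "{#}" S k a b c]
    by (simp add: monomial_empty)
qed

text \<open>The zero index contributes 1; at any other index some variable occurs with positive
  exponent.\<close>

lemma q_power_dvd_T:
  assumes "q ^ k dvd a" "q ^ k dvd b" "q ^ k dvd c"
  shows "q ^ k dvd T a b c - 1"
proof -
  have "q ^ k dvd T_term a b c n1 n2 n3" if "(n1, n2, n3) \<noteq> (0, 0, 0)" for n1 n2 n3
  proof -
    from that consider "n1 > 0" | "n2 > 0" | "n3 > 0" by auto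
    then have "q ^ k dvd a ^ n1 * b ^ n2 * c ^ n3"
    proof cases
      case 1
      then show ?thesis using assms(1) by (meson dvd_mult2 dvd_power dvd_trans)
    next
      case 2
      then show ?thesis using assms(2) by (meson dvd_mult dvd_mult2 dvd_power dvd_trans)
    next
      case 3
      then show ?thesis using assms(3) by (meson dvd_mult dvd_power dvd_trans)
    qed
    moreover have "T_term a b c n1 n2 n3 = a ^ n1 * b ^ n2 * c ^ n3 *
        (q ^ exponent n1 n2 n3 * qpoch (- q) q (n1 + n2 + n3) *
          inv_poch n1 * inv_poch n2 * inv_poch n3)"
      unfolding T_term_eq by (simp only: mult_ac)
    ultimately show ?thesis by simp
  qed
  moreover have "T_term a b c 0 0 0 = 1"
    by (simp add: T_term_eq inv_poch_0 qpoch_def numeral_2_eq_2)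
  ultimately show ?thesis
    using q_power_dvd_has_sum_diff[OF T_has_sum, of "(0, 0, 0)" k a b c] by auto
qed

text \<open>The system is homogeneous and expresses the values at \<open>k\<close> through those at
  k + 1, which are divisible by one more power of \<open>q\<close>. Iteration makes the values at
  \<open>k\<close> divisible by every power.\<close>

lemma q_adic_system_vanishes:
  fixes A E C D :: "nat \<Rightarrow> series"
  assumes base: "\<And>k. q ^ k dvd A k" "\<And>k. q ^ k dvd E k" "\<And>k. q ^ k dvd C k" "\<And>k. q ^ k dvd D k"
    and rec: "\<And>k. A k = A (Suc k) + t k * C (Suc k) + w k * D (Suc k)"
      "\<And>k. E k = A (Suc k) + v k * C (Suc k) + w k * D (Suc k)"
      "\<And>k. C k = E (Suc k) + v k * C (Suc k)"
      "\<And>k. D k = A (Suc k) + w k * D (Suc k)"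
  shows "A k = 0 \<and> E k = 0 \<and> C k = 0 \<and> D k = 0"
proof -
  \<comment> \<open>Here \<open>d\<close> counts the uses of the recursion; \<open>k\<close> stays
    arbitrary because each use moves to \<open>Suc k\<close>.\<close>
  have *: "q ^ (k + d) dvd A k \<and> q ^ (k + d) dvd E k \<and> q ^ (k + d) dvd C k \<and> q ^ (k + d) dvd D k"
    for k d
  proof (induction d arbitrary: k)
    case 0
    then show ?case using base by simp
  next
    case (Suc d)
    then have "q ^ (k + Suc d) dvd A (Suc k)" "q ^ (k + Suc d) dvd E (Suc k)"
      "q ^ (k + Suc d) dvd C (Suc k)" "q ^ (k + Suc d) dvd D (Suc k)"
      by (metis add_Suc_shift)+
    then show ?case
      unfolding rec[of k] by (intro conjI dvd_add dvd_mult)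
  qed
  have "q ^ d dvd A k \<and> q ^ d dvd E k \<and> q ^ d dvd C k \<and> q ^ d dvd D k" for d
    using *[where k = k and d = d] by (meson dvd_trans le_add2 le_imp_power_dvd)
  then show ?thesis
    by (blast intro: all_q_powers_dvd_imp_zero)
qed

section \<open>The system for the four generating functions and for the four combinations of
  \<open>T\<close>\<close>

lemma color_not_simps:
  "{d. (1, d) \<notin> ({} :: cpart set)} = {R, G, B}"
  "{d. (1, d) \<notin> {(1 :: nat, R)}} = {G, B}"
  "{d. (1, d) \<notin> {(1 :: nat, R), (2, R), (1, B)}} = {G}"
  "{d. (1, d) \<notin> {(1 :: nat, R), (1, G)}} = {B}"
  using color.exhaust by auto

lemma lower_simps:
  "lower {} = {}" "lower {(1, R)} = {}" "lower {(1, R), (1, G)} = {}"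
  "lower {(1, R), (2, R), (1, B)} = {(1, R)}"
  by (auto simp: lower_def)

lemma next_avoid_simps:
  "next_avoid R = {(1, R), (2, R), (1, B)}" "next_avoid G = {(1, R), (2, R), (1, B)}"
  "next_avoid B = {(1, R), (1, G)}"
  by (simp_all add: next_avoid_def)

text \<open>Red and green parts of size 1 exclude the same parts, which is why a + b appears in the
  first equation.\<close>

lemma GF_system:
  fixes a b c :: series
  defines "F \<equiv> \<lambda>S. GF (Lam_avoid S) (a * q) (b * q) (c * q)"
  shows
  "GF (Lam_avoid {}) a b c = F {} + (a + b) * q * F {(1, R), (2, R), (1, B)}
     + c * q * F {(1, R), (1, G)}"
  "GF (Lam_avoid {(1, R)}) a b c = F {} + b * q * F {(1, R), (2, R), (1, B)}
     + c * q * F {(1, R), (1, G)}"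
  "GF (Lam_avoid {(1, R), (2, R), (1, B)}) a b c
     = F {(1, R)} + b * q * F {(1, R), (2, R), (1, B)}"
  "GF (Lam_avoid {(1, R), (1, G)}) a b c = F {} + c * q * F {(1, R), (1, G)}"
proof -
  \<comment> \<open>The part \<open>1_R\<close> left over from \<open>2_R\<close> is already
    excluded by the green part of size 1, so no fifth set arises.\<close>
  have "next_avoid G \<union> {(1, R)} = {(1, R), (2, R), (1, B)}"
    by (auto simp: next_avoid_def)
  then show "GF (Lam_avoid {(1, R), (2, R), (1, B)}) a b c
     = F {(1, R)} + b * q * F {(1, R), (2, R), (1, B)}"
    unfolding GF_recursion[of "{(1, R), (2, R), (1, B)}" a b c] color_not_simps lower_simps F_def
    by (simp add: part_var_def)
qed (unfold GF_recursion[of _ a b c] color_not_simps lower_simps F_def,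
     simp_all add: part_var_def next_avoid_simps distrib_right)

text \<open>\<open>T_eq_mixed\<close> compares \<open>A\<close> with \<open>E\<close>,
  \<open>T_eq_shift3\<close> is the equation for \<open>D\<close>, and \<open>T_eq_shift2\<close>
  the one for \<open>C\<close>; the other equations follow, since \<open>E\<close> is
  \<open>D\<close> plus a multiple of the shifted \<open>C\<close>.\<close>

lemma T_system:
  fixes A E C D :: "series \<Rightarrow> series \<Rightarrow> series \<Rightarrow> series"
  defines "A \<equiv> \<lambda>a b c. T (a * q) (b * q) (c * q\<^sup>2) + c * q * T (a * q ^ 3) (b * q ^ 3) (c * q\<^sup>2)"
    and "E \<equiv> \<lambda>a b c. T (a * q\<^sup>2) (b * q\<^sup>2) (c * q) + b * q * T (a * q ^ 4) (b * q\<^sup>2) (c * q ^ 3)"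
    and "C \<equiv> \<lambda>a b c. T (a * q ^ 3) (b * q) (c * q\<^sup>2)"
    and "D \<equiv> \<lambda>a b c. T (a * q\<^sup>2) (b * q\<^sup>2) (c * q)"
  shows "A a b c = A (a * q) (b * q) (c * q) + (a + b) * q * C (a * q) (b * q) (c * q)
       + c * q * D (a * q) (b * q) (c * q)"
    and "E a b c = A (a * q) (b * q) (c * q) + b * q * C (a * q) (b * q) (c * q)
       + c * q * D (a * q) (b * q) (c * q)"
    and "C a b c = E (a * q) (b * q) (c * q) + b * q * C (a * q) (b * q) (c * q)"
    and "D a b c = A (a * q) (b * q) (c * q) + c * q * D (a * q) (b * q) (c * q)"
proof -
  have AE: "A a b c = E a b c + a * q * C (a * q) (b * q) (c * q)"
    using T_eq_mixed[of "a * q" "b * q" "c * q"]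
    unfolding A_def E_def C_def by (simp add: eval_nat_numeral algebra_simps)
  have ED: "E a b c = D a b c + b * q * C (a * q) (b * q) (c * q)"
    unfolding E_def C_def D_def by (simp add: eval_nat_numeral algebra_simps)
  show D: "D a b c = A (a * q) (b * q) (c * q) + c * q * D (a * q) (b * q) (c * q)"
    using T_eq_shift3[of "a * q\<^sup>2" "b * q\<^sup>2" "c * q"]
    unfolding A_def D_def by (simp add: eval_nat_numeral algebra_simps)
  show "C a b c = E (a * q) (b * q) (c * q) + b * q * C (a * q) (b * q) (c * q)"
    using T_eq_shift2[of "a * q ^ 3" "b * q" "c * q\<^sup>2"]
    unfolding C_def E_def by (simp add: eval_nat_numeral algebra_simps)
  show "E a b c = A (a * q) (b * q) (c * q) + b * q * C (a * q) (b * q) (c * q)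
       + c * q * D (a * q) (b * q) (c * q)"
    unfolding ED D by (simp only: add_ac)
  then show "A a b c = A (a * q) (b * q) (c * q) + (a + b) * q * C (a * q) (b * q) (c * q)
       + c * q * D (a * q) (b * q) (c * q)"
    unfolding AE by (simp add: algebra_simps)
qed

theorem theorem1p1:
  shows "GF Lam y1 y2 y3
           = T (y1 * q) (y2 * q) (y3 * q^2) + y3 * q * T (y1 * q^3) (y2 * q^3) (y3 * q^2)
       \<and> GF (Lam_avoid {(1, R)}) y1 y2 y3
           = T (y1 * q^2) (y2 * q^2) (y3 * q) + y2 * q * T (y1 * q^4) (y2 * q^2) (y3 * q^3)
       \<and> GF (Lam_avoid {(1, R), (2, R), (1, B)}) y1 y2 y3
           = T (y1 * q^3) (y2 * q) (y3 * q^2)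
       \<and> GF (Lam_avoid {(1, R), (1, G)}) y1 y2 y3
           = T (y1 * q^2) (y2 * q^2) (y3 * q)"
proof -
  \<comment> \<open>From here on the four letters denote differences of the two solutions; by
    linearity these satisfy the same system.\<close>
  define A where "A a b c = GF (Lam_avoid {}) a b c -
    (T (a * q) (b * q) (c * q\<^sup>2) + c * q * T (a * q ^ 3) (b * q ^ 3) (c * q\<^sup>2))" for a b c
  define E where "E a b c = GF (Lam_avoid {(1, R)}) a b c -
    (T (a * q\<^sup>2) (b * q\<^sup>2) (c * q) + b * q * T (a * q ^ 4) (b * q\<^sup>2) (c * q ^ 3))" for a b c
  define C where "C a b c = GF (Lam_avoid {(1, R), (2, R), (1, B)}) a b c -
    T (a * q ^ 3) (b * q) (c * q\<^sup>2)" for a b c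
  define D where "D a b c = GF (Lam_avoid {(1, R), (1, G)}) a b c -
    T (a * q\<^sup>2) (b * q\<^sup>2) (c * q)" for a b c
  have rec:
    "A a b c = A (a * q) (b * q) (c * q) + (a + b) * q * C (a * q) (b * q) (c * q)
       + c * q * D (a * q) (b * q) (c * q)"
    "E a b c = A (a * q) (b * q) (c * q) + b * q * C (a * q) (b * q) (c * q)
       + c * q * D (a * q) (b * q) (c * q)"
    "C a b c = E (a * q) (b * q) (c * q) + b * q * C (a * q) (b * q) (c * q)"
    "D a b c = A (a * q) (b * q) (c * q) + c * q * D (a * q) (b * q) (c * q)" for a b c
    unfolding A_def E_def C_def D_def
    subgoal by (simp only: GF_system(1)[of a b c] T_system(1)[of a b c] right_diff_distrib add_diff_add)
    subgoal by (simp only: GF_system(2)[of a b c] T_system(2)[of a b c] right_diff_distrib add_diff_add)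
    subgoal by (simp only: GF_system(3)[of a b c] T_system(3)[of a b c] right_diff_distrib add_diff_add)
    subgoal by (simp only: GF_system(4)[of a b c] T_system(4)[of a b c] right_diff_distrib add_diff_add)
    done
  have base: "q ^ k dvd A a b c" "q ^ k dvd E a b c" "q ^ k dvd C a b c" "q ^ k dvd D a b c"
    if "q ^ k dvd a" "q ^ k dvd b" "q ^ k dvd c" for k a b c
  proof -
    have GF: "q ^ k dvd GF (Lam_avoid S) a b c - 1" for S
      by (rule q_power_dvd_GF) fact+
    have T: "q ^ k dvd T (a * f) (b * g) (c * h) - 1" for f g h
      by (rule q_power_dvd_T) (use that in auto)
    have 1: "q ^ k dvd GF (Lam_avoid S) a b c - T (a * f) (b * g) (c * h)" for S f g h
      using dvd_diff[OF GF[of S] T[of f g h]] by simp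
    show "q ^ k dvd C a b c" "q ^ k dvd D a b c" unfolding C_def D_def by (rule 1)+
    \<comment> \<open>The second summand of each combination carries the factor \<open>c\<close> or
      \<open>b\<close>, so it is divisible by itself.\<close>
    show "q ^ k dvd A a b c" "q ^ k dvd E a b c"
      unfolding A_def E_def diff_diff_eq[symmetric] using that
      by (intro dvd_diff 1; simp add: dvd_mult2 mult.assoc)+
  qed
  have pw: "y * q ^ k * q = y * q ^ Suc k" for y :: series and k
    by simp
  \<comment> \<open>The sequences follow the points (y1 q^k, y2 q^k, y3 q^k), whose coordinates are
    divisible by q^k. The coefficients are in the shape that \<open>pw\<close> leaves in
    \<open>rec\<close>: it merges powers in \<open>v\<close> and \<open>w\<close>, but not across
    the sum in \<open>t\<close>.\<close>
  note system = q_adic_system_vanishes[where k = 0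
    and A = "\<lambda>k. A (y1 * q ^ k) (y2 * q ^ k) (y3 * q ^ k)"
    and E = "\<lambda>k. E (y1 * q ^ k) (y2 * q ^ k) (y3 * q ^ k)"
    and C = "\<lambda>k. C (y1 * q ^ k) (y2 * q ^ k) (y3 * q ^ k)"
    and D = "\<lambda>k. D (y1 * q ^ k) (y2 * q ^ k) (y3 * q ^ k)"
    and t = "\<lambda>k. (y1 * q ^ k + y2 * q ^ k) * q" and v = "\<lambda>k. y2 * q ^ Suc k"
    and w = "\<lambda>k. y3 * q ^ Suc k"]
  have "A (y1 * q ^ 0) (y2 * q ^ 0) (y3 * q ^ 0) = 0 \<and> E (y1 * q ^ 0) (y2 * q ^ 0) (y3 * q ^ 0) = 0
      \<and> C (y1 * q ^ 0) (y2 * q ^ 0) (y3 * q ^ 0) = 0 \<and> D (y1 * q ^ 0) (y2 * q ^ 0) (y3 * q ^ 0) = 0"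
    by (rule system)
      (rule base rec[of "y1 * q ^ _" "y2 * q ^ _" "y3 * q ^ _", unfolded pw] dvd_triv_right)+
  moreover have "Lam_avoid {} = Lam" by (simp add: Lam_avoid_def)
  ultimately show ?thesis
    unfolding A_def E_def C_def D_def by simp
qed

end
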